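(* Let $n,m\ge 1$ and let $f=(f_1,\dots,f_m)\colon\mathbb{R}^n\to\mathbb{R}^m$ with each $f_j$ continuously differentiable. Assume that for each $j\in\{1,\dots,m\}$ there is $L_j>0$ with $\|\nabla f_j(x)-\nabla f_j(x')\|_2\le L_j\|x-x'\|_2$ for all $x,x'\in\mathbb{R}^n$, and put $L_{\max}:=\max_j L_j$. Assume that the problem $\min_{x\in\mathbb{R}^n} f(x)$ has at least one weakly efficient point. Let $\Phi(x):=\max_{j} f_j(x)$, let $\Phi_{\rm low}\in\mathbb{R}$ satisfy $\Phi(x)\ge\Phi_{\rm low}$ for all $x\in\mathbb{R}^n$, let $x^0\in\mathbb{R}^n$ and $\varsigma\in(0,1)$, and put $\Gamma_0:=\Phi(x^0)-\Phi_{\rm low}$. Let $(x^k)_{k\ge 0}$ and $(g_k^s)_{k\ge0}$ be generated by the MO-Adagrad algorithm (defined in the context) applied to $f$ with starting point $x^0$ and parameter $\varsigma$. Then for every $k\ge 0$ $$\frac{1}{k+1}\sum_{\ell=0}^k \omega(x^\ell)=\frac{1}{k+1}\sum_{\ell=0}^k\|g_\ell^s\|_2^2\le\frac{\theta}{k+1},$$ where $$\theta=\max\left\{\varsigma,\ \frac{\varsigma}{2}\,e^{2\Gamma_0/L_{\max}},\ \frac{2048\,L_{\max}^4}{\varsigma}\right\}.$$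
   Context: A point $\bar x\in\mathbb{R}^n$ is weakly efficient if there is no $x\in\mathbb{R}^n$ with $f_j(x)<f_j(\bar x)$ for all $j\in\{1,\dots,m\}$. For $x\in\mathbb{R}^n$, $\omega(x)$ denotes the optimal value of $$\min_{\lambda\in\mathbb{R}^m}\Big\|\sum_{j=1}^m\lambda_j\nabla f_j(x)\Big\|_2^2\quad\text{s.t. }\sum_{j=1}^m\lambda_j=1,\ \lambda\ge 0.\qquad(\Omega(x))$$ MO-Adagrad algorithm: given $x^0\in\mathbb{R}^n$ and $\varsigma\in(0,1)$, set $w_{-1}=\sqrt{\varsigma}$. For $k=0,1,2,\dots$: let $\lambda^k$ be an optimal solution of $(\Omega(x^k))$ and set $g_k^s:=\sum_{j=1}^m\lambda_j^k\nabla f_j(x^k)$ (this is the unique minimum-norm vector in the convex hull of the gradients $\nabla f_j(x^k)$); set $w_k=\sqrt{w_{k-1}^2+\|g_k^s\|_2^2}$, $s^k=-\frac{1}{w_k}g_k^s$, and $x^{k+1}=x^k+s^k$. *)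

theory Defs
  imports "HOL-Analysis.Analysis"
begin

definition grad :: "('a::real_inner \<Rightarrow> real) \<Rightarrow> 'a \<Rightarrow> 'a" where
  "grad h x = (THE D. GDERIV h x :> D)"

lemma gderiv_grad:
  fixes h :: "'a::euclidean_space \<Rightarrow> real"
  assumes "h differentiable (at x)"
  shows "GDERIV h x :> grad h x"
proof -
  obtain h' where h': "(h has_derivative h') (at x)"
    using assms by (auto simp: differentiable_def)
  then have "h' = (\<lambda>v. inner v (adjoint h' 1))"
    using adjoint_works[OF bounded_linear.linear[OF has_derivative_bounded_linear[OF h']], where y = 1]
    by (auto simp: fun_eq_iff inner_commute)
  with h' have D: "GDERIV h x :> adjoint h' 1"
    by (simp add: gderiv_def)
  have "D = E" if "GDERIV h x :> D" "GDERIV h x :> E" for D E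
  proof -
    have "(\<lambda>v. inner v D) = (\<lambda>v. inner v E)"
      using that unfolding gderiv_def by (rule has_derivative_unique)
    then show ?thesis
      by (metis vector_eq_ldot)
  qed
  with D show ?thesis
    unfolding grad_def by (metis theI)
qed

definition continuously_differentiable :: "('a::euclidean_space \<Rightarrow> real) \<Rightarrow> bool" where
  "continuously_differentiable h \<longleftrightarrow>
     (\<forall>x. h differentiable (at x)) \<and> continuous_on UNIV (grad h)"

definition weakly_efficient :: "('a \<Rightarrow> real ^ 'm) \<Rightarrow> 'a \<Rightarrow> bool" where
  "weakly_efficient f z \<longleftrightarrow> \<not> (\<exists>x. \<forall>j. f x $ j < f z $ j)"

definition unit_simplex :: "(real ^ 'm) set" where
  "unit_simplex = {l. (\<Sum>j\<in>UNIV. l $ j) = 1 \<and> (\<forall>j. 0 \<le> l $ j)}"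

definition grad_comb :: "(real ^ 'n \<Rightarrow> real ^ 'm) \<Rightarrow> real ^ 'n \<Rightarrow> real ^ 'm \<Rightarrow> real ^ 'n" where
  "grad_comb f x l = (\<Sum>j\<in>UNIV. l $ j *\<^sub>R grad (\<lambda>y. f y $ j) x)"

definition optimal_weights :: "(real ^ 'n \<Rightarrow> real ^ 'm) \<Rightarrow> real ^ 'n \<Rightarrow> real ^ 'm \<Rightarrow> bool" where
  "optimal_weights f x l \<longleftrightarrow>
     is_arg_min (\<lambda>l. (norm (grad_comb f x l))\<^sup>2) (\<lambda>l. l \<in> unit_simplex) l"

definition omega :: "(real ^ 'n \<Rightarrow> real ^ 'm) \<Rightarrow> real ^ 'n \<Rightarrow> real" where
  "omega f x = (INF l\<in>unit_simplex. (norm (grad_comb f x l))\<^sup>2)"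

(* The scaling sequence is shifted by one: w 0 is the initial value w_{-1},
   and w (Suc k) is the scaling w_k used in step k. *)
definition mo_adagrad ::
  "(real ^ 'n \<Rightarrow> real ^ 'm) \<Rightarrow> real ^ 'n \<Rightarrow> real \<Rightarrow>
   (nat \<Rightarrow> real ^ 'n) \<Rightarrow> (nat \<Rightarrow> real ^ 'n) \<Rightarrow> bool" where
  "mo_adagrad f x0 \<sigma> x g \<longleftrightarrow>
     (\<exists>(lam :: nat \<Rightarrow> real ^ 'm) (w :: nat \<Rightarrow> real) (s :: nat \<Rightarrow> real ^ 'n).
        x 0 = x0 \<and> w 0 = sqrt \<sigma> \<and>
        (\<forall>k. optimal_weights f (x k) (lam k) \<and>
             g k = grad_comb f (x k) (lam k) \<and>
             w (Suc k) = sqrt ((w k)\<^sup>2 + (norm (g k))\<^sup>2) \<and>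
             s k = - ((1 / w (Suc k)) *\<^sub>R g k) \<and>
             x (Suc k) = x k + s k))"

definition max_component :: "('a \<Rightarrow> real ^ 'm) \<Rightarrow> 'a \<Rightarrow> real" where
  "max_component f x = Max (range (\<lambda>j. f x $ j))"

end

(* Moving along minus the minimum-norm convex combination g of the gradients decreases every
   component to first order by at least |g|^2 per unit, so with step 1/w_k
     Phi(x_{k+1}) <= Phi(x_k) - |g_k|^2 / w_k + L_max |g_k|^2 / (2 w_k^2).
   Write S for the sum of the |g_l|^2 up to k, so that w_k^2 = varsigma + S.  Summed over the steps,
   the first-order terms are at least S / w_k while the quadratic terms are at most
   (L_max / 2) ln (w_k^2 / varsigma).  If S exceeds the first two entries of theta, this collapses
   to sqrt (S / 2) <= L_max ln (2 S / varsigma), and ln u <= 4 u^(1/4) turns that into the third. *)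

theory Submission
  imports Defs
begin

text \<open>Along the segment from \<open>y\<close> to \<open>y + s\<close>, \<open>h\<close> minus
  its quadratic upper model is nonincreasing: Cauchy-Schwarz and the Lipschitz bound at distance
  \<open>t * norm s\<close> make the derivative at \<open>t\<close> nonpositive. The function
  \<open>p\<close> is this difference up to the constant \<open>h y\<close>.\<close>

lemma lipschitz_gradient_descent:
  fixes h :: "'a::euclidean_space \<Rightarrow> real"
  assumes "\<And>y. h differentiable (at y)"
    and "\<And>y y'. norm (grad h y - grad h y') \<le> L * norm (y - y')"
  shows "h (y + s) \<le> h y + inner (grad h y) s + L / 2 * (norm s)\<^sup>2"
proof -
  define p where "p t = h (y + t *\<^sub>R s) - t * inner (grad h y) s - L / 2 * (norm s)\<^sup>2 * t\<^sup>2"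
    for t :: real
  have "p 1 \<le> p 0"
  proof (rule DERIV_nonpos_imp_nonincreasing[where f = p])
    fix t :: real
    assume t: "0 \<le> t" "t \<le> 1"
    have h: "(h has_derivative (\<lambda>v. inner v (grad h (y + t *\<^sub>R s)))) (at (y + t *\<^sub>R s))"
      using gderiv_grad[OF assms(1)] by (simp add: gderiv_def)
    have "((\<lambda>t. h (y + t *\<^sub>R s)) has_derivative (\<lambda>u. inner (u *\<^sub>R s) (grad h (y + t *\<^sub>R s)))) (at t)"
      by (rule has_derivative_compose[where f = "\<lambda>t. y + t *\<^sub>R s", OF _ h]) (auto intro!: derivative_eq_intros)
    then have "((\<lambda>t. h (y + t *\<^sub>R s)) has_real_derivative inner s (grad h (y + t *\<^sub>R s))) (at t)"
      unfolding has_field_derivative_def by (rule has_derivative_eq_rhs) (auto simp: fun_eq_iff)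
    then have "(p has_real_derivative inner s (grad h (y + t *\<^sub>R s)) - inner (grad h y) s
        - L / 2 * (norm s)\<^sup>2 * (2 * t)) (at t)"
      unfolding p_def by (auto intro!: derivative_eq_intros)
    moreover have "inner s (grad h (y + t *\<^sub>R s)) - inner (grad h y) s
        \<le> L / 2 * (norm s)\<^sup>2 * (2 * t)"
    proof -
      have "inner s (grad h (y + t *\<^sub>R s)) - inner (grad h y) s
          = inner s (grad h (y + t *\<^sub>R s) - grad h y)"
        by (simp add: inner_diff_right inner_commute)
      also have "\<dots> \<le> norm s * norm (grad h (y + t *\<^sub>R s) - grad h y)"
        by (rule norm_cauchy_schwarz)
      also have "\<dots> \<le> norm s * (L * (t * norm s))"
        using assms(2)[of "y + t *\<^sub>R s" y] t by (intro mult_left_mono) auto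
      finally show ?thesis
        by (simp add: power2_eq_square mult_ac)
    qed
    ultimately show "\<exists>d. (p has_real_derivative d) (at t) \<and> d \<le> 0"
      by (metis diff_le_0_iff_le)
  qed simp
  then show ?thesis
    by (simp add: p_def)
qed

lemma grad_comb_axis: "grad_comb f x (axis j 1) = grad (\<lambda>y. f y $ j) x"
proof -
  have "grad_comb f x (axis j 1)
      = (\<Sum>i\<in>UNIV. if i = j then grad (\<lambda>y. f y $ i) x else 0)"
    unfolding grad_comb_def axis_def by (intro sum.cong) auto
  then show ?thesis
    by simp
qed

lemma grad_comb_segment:
  "grad_comb f x ((1 - u) *\<^sub>R l + u *\<^sub>R l')
     = grad_comb f x l + u *\<^sub>R (grad_comb f x l' - grad_comb f x l)"
  by (simp add: grad_comb_def scaleR_left_distrib sum.distrib scaleR_diff_left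
      scaleR_diff_right scaleR_sum_right sum_subtractf algebra_simps)

lemma axis_in_unit_simplex: "axis j 1 \<in> unit_simplex"
  by (simp add: unit_simplex_def axis_def)

lemma unit_simplex_segment:
  assumes "l \<in> unit_simplex" "l' \<in> unit_simplex" "0 \<le> u" "u \<le> 1"
  shows "(1 - u) *\<^sub>R l + u *\<^sub>R l' \<in> unit_simplex"
  using assms by (simp add: unit_simplex_def sum.distrib flip: sum_distrib_left)

text \<open>First-order optimality of the projection of 0 onto the convex hull of the gradients. If
  it failed, 0 and the gradient \<open>?v\<close> would lie at an acute angle seen from
  \<open>?g\<close>, so a small move from \<open>?g\<close> towards \<open>?v\<close> would stay in
  the hull and come closer to 0.\<close>

lemma optimal_weights_inner_ge:
  assumes "optimal_weights f x l"
  shows "(norm (grad_comb f x l))\<^sup>2 \<le> inner (grad (\<lambda>y. f y $ j) x) (grad_comb f x l)"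
proof (rule ccontr)
  let ?g = "grad_comb f x l" and ?v = "grad (\<lambda>y. f y $ j) x"
  assume "\<not> ?thesis"
  then have "inner (0 - ?g) (?v - ?g) > 0"
    by (simp add: inner_diff_right inner_commute power2_norm_eq_inner)
  then obtain u where u: "u > 0" "u \<le> 1" "dist (?g + u *\<^sub>R (?v - ?g)) 0 < dist ?g 0"
    using closer_point_lemma by blast
  \<comment> \<open>Since \<open>grad_comb\<close> is linear in the weights, sliding them towards
    vertex \<open>j\<close> of the simplex realizes exactly the closer point.\<close>
  let ?l = "(1 - u) *\<^sub>R l + u *\<^sub>R axis j 1"
  have "l \<in> unit_simplex"
    using assms by (simp add: optimal_weights_def is_arg_min_def)
  then have "?l \<in> unit_simplex"
    using u by (intro unit_simplex_segment axis_in_unit_simplex) auto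
  then have "\<not> (norm (grad_comb f x ?l))\<^sup>2 < (norm ?g)\<^sup>2"
    using assms by (simp add: optimal_weights_def is_arg_min_def)
  moreover have "norm (grad_comb f x ?l) < norm ?g"
    using u by (simp add: grad_comb_segment grad_comb_axis)
  ultimately show False
    by (simp add: power_strict_mono)
qed

lemma omega_eq_optimal_weights:
  assumes "optimal_weights f x l"
  shows "omega f x = (norm (grad_comb f x l))\<^sup>2"
  unfolding omega_def
  by (rule cInf_eq_minimum)
    (use assms in \<open>auto simp: optimal_weights_def is_arg_min_def not_less\<close>)

text \<open>One direction serves all components at once: minimality of the combination gives each of
  them a slope of at most \<open>- (norm ?g)\<^sup>2\<close>, so the bound is uniform in
  \<open>j\<close> and survives taking the maximum.\<close>

lemma max_component_descent:
  fixes f :: "real ^ 'n \<Rightarrow> real ^ 'm"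
  assumes "\<And>j y. (\<lambda>z. f z $ j) differentiable (at y)"
    and "\<And>j y y'. norm (grad (\<lambda>z. f z $ j) y - grad (\<lambda>z. f z $ j) y') \<le> L * norm (y - y')"
    and "optimal_weights f y l" "0 \<le> t"
  shows "max_component f (y - t *\<^sub>R grad_comb f y l)
    \<le> max_component f y - t * (norm (grad_comb f y l))\<^sup>2 + L / 2 * (t\<^sup>2 * (norm (grad_comb f y l))\<^sup>2)"
proof -
  let ?g = "grad_comb f y l"
  have "f (y - t *\<^sub>R ?g) $ j
      \<le> max_component f y - t * (norm ?g)\<^sup>2 + L / 2 * (t\<^sup>2 * (norm ?g)\<^sup>2)" for j
  proof -
    have "f (y - t *\<^sub>R ?g) $ j \<le> f y $ j - t * inner (grad (\<lambda>z. f z $ j) y) ?g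
        + L / 2 * (t\<^sup>2 * (norm ?g)\<^sup>2)"
      using lipschitz_gradient_descent[where h = "\<lambda>z. f z $ j" and y = y and s = "- t *\<^sub>R ?g",
          OF assms(1,2)]
      by (simp add: power_mult_distrib)
    moreover have "t * (norm ?g)\<^sup>2 \<le> t * inner (grad (\<lambda>z. f z $ j) y) ?g"
      using assms(3,4) by (intro mult_left_mono optimal_weights_inner_ge)
    moreover have "f y $ j \<le> max_component f y"
      unfolding max_component_def by simp
    ultimately show ?thesis
      by linarith
  qed
  then show ?thesis
    by (subst (1) max_component_def) auto
qed

text \<open>The scalar core of the analysis, with \<open>a k\<close> standing for the squared norm
  of the direction in step \<open>k\<close>. The induction sums the first-order gains and the
  quadratic losses separately.\<close>

lemma adagrad_weighted_sum_bound:
  fixes a w \<Phi> :: "nat \<Rightarrow> real"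
  assumes "0 < \<sigma>" "0 \<le> L" "w 0 = sqrt \<sigma>" "\<And>k. 0 \<le> a k"
    and "\<And>k. w (Suc k) = sqrt ((w k)\<^sup>2 + a k)"
    and "\<And>k. \<Phi> (Suc k) \<le> \<Phi> k - a k / w (Suc k) + L / 2 * (a k / (w (Suc k))\<^sup>2)"
  shows "(\<Sum>l<k. a l) / sqrt (\<sigma> + (\<Sum>l<k. a l))
    \<le> \<Phi> 0 - \<Phi> k + L / 2 * ln ((\<sigma> + (\<Sum>l<k. a l)) / \<sigma>)"
proof -
  \<comment> \<open>With the scaling sequence shifted by one, \<open>q k\<close> collects the first
    \<open>k\<close> terms and equals the square of \<open>w k\<close>.\<close>
  define q where "q k = \<sigma> + (\<Sum>l<k. a l)" for k
  have q_pos: "0 < q k" for k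
    unfolding q_def using assms(1,4) by (intro add_pos_nonneg sum_nonneg)
  have q_Suc: "q (Suc k) = q k + a k" for k
    by (simp add: q_def)
  have w: "w k = sqrt (q k)" for k
  proof (induction k)
    case (Suc k)
    then show ?case
      using q_pos[of k] assms(5)[of k] by (simp add: q_Suc)
  qed (simp add: q_def assms(3))
  have "(\<Sum>l<k. a l) / sqrt (q k) \<le> \<Phi> 0 - \<Phi> k + L / 2 * ln (q k / \<sigma>)"
  proof (induction k)
    case 0
    then show ?case
      using assms(1) by (simp add: q_def)
  next
    case (Suc k)
    \<comment> \<open>Applying \<open>ln r \<le> r - 1\<close> to the ratio of consecutive
      \<open>q\<close> bounds the quadratic term by a difference of logarithms, which
      telescopes.\<close>
    have "ln (q k / q (Suc k)) \<le> q k / q (Suc k) - 1"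
      using q_pos by (intro ln_le_minus_one) simp
    moreover have "q k / q (Suc k) - 1 = - (a k / q (Suc k))"
      using q_pos[of "Suc k"] by (simp add: q_Suc field_simps)
    ultimately have "a k / q (Suc k) \<le> ln (q (Suc k) / \<sigma>) - ln (q k / \<sigma>)"
      using q_pos[of k] q_pos[of "Suc k"] assms(1) by (simp add: ln_div)
    then have "L / 2 * (a k / q (Suc k)) \<le> L / 2 * (ln (q (Suc k) / \<sigma>) - ln (q k / \<sigma>))"
      using assms(2) by (intro mult_left_mono) auto
    then have *: "L / 2 * (a k / q (Suc k)) \<le> L / 2 * ln (q (Suc k) / \<sigma>) - L / 2 * ln (q k / \<sigma>)"
      by (simp add: right_diff_distrib)
    \<comment> \<open>Moving the old sum to the larger new scale only decreases it; adding the new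
      term at that same scale gives the next quotient.\<close>
    have "(\<Sum>l<k. a l) / sqrt (q (Suc k)) \<le> (\<Sum>l<k. a l) / sqrt (q k)"
      using q_pos[of k] assms(4) by (intro frac_le sum_nonneg) (auto simp: q_Suc)
    moreover have "\<Phi> (Suc k) \<le> \<Phi> k - a k / sqrt (q (Suc k)) + L / 2 * (a k / q (Suc k))"
      using assms(6)[of k] q_pos[of "Suc k"] by (simp add: w)
    ultimately show ?case
      using Suc.IH * by (simp add: add_divide_distrib)
  qed
  then show ?thesis
    by (simp add: q_def)
qed

lemma adagrad_bound_from_log:
  fixes S :: real
  assumes "0 < \<sigma>" "0 < L"
    and bound: "S / sqrt (\<sigma> + S) \<le> \<Gamma> + L / 2 * ln ((\<sigma> + S) / \<sigma>)"
    and "\<sigma> < S" "\<sigma> / 2 * exp (2 * \<Gamma> / L) < S"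
  shows "S \<le> 2048 * L ^ 4 / \<sigma>"
proof -
  \<comment> \<open>Chosen so that \<open>\<sigma> < S\<close> gives
    \<open>\<sigma> + S \<le> 2 * S = \<sigma> * u\<close>, and so that the exponential hypothesis
    reads \<open>exp (2 * \<Gamma> / L) < u\<close>, which absorbs \<Gamma> into a second copy of
    \<open>L / 2 * ln u\<close>.\<close>
  define u where "u = 2 * S / \<sigma>"
  define v where "v = root 4 u"
  have u: "0 < u" and S: "S = \<sigma> * u / 2"
    using assms(1,4) by (auto simp: u_def)
  then have v: "0 < v" "v ^ 4 = u"
    by (auto simp: v_def)
  have v_sq: "(v\<^sup>2)\<^sup>2 = u"
    using v(2) by (simp flip: power_mult)
  have "exp (2 * \<Gamma> / L) < u"
    using assms(1,5) by (simp add: u_def field_simps)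
  then have "2 * \<Gamma> / L \<le> ln u"
    using u by (simp add: ln_ge_iff)
  then have "\<Gamma> \<le> L / 2 * ln u"
    using assms(2) by (simp add: field_simps)
  moreover have "L / 2 * ln ((\<sigma> + S) / \<sigma>) \<le> L / 2 * ln u"
    using assms(1,2,4) by (intro mult_left_mono) (auto simp: u_def divide_right_mono)
  moreover have "sqrt \<sigma> * v\<^sup>2 / 2 \<le> S / sqrt (\<sigma> + S)"
  proof -
    have "sqrt (\<sigma> + S) \<le> sqrt (\<sigma> * u)"
      using S assms(4) by simp
    also have "\<dots> = sqrt \<sigma> * v\<^sup>2"
      using v by (simp add: real_sqrt_mult real_sqrt_unique[OF v_sq])
    finally have "S / (sqrt \<sigma> * v\<^sup>2) \<le> S / sqrt (\<sigma> + S)"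
      using assms(1,4) v by (intro divide_left_mono) auto
    moreover have "S / (sqrt \<sigma> * v\<^sup>2) = sqrt \<sigma> * v\<^sup>2 / 2"
    proof -
      have "S = (sqrt \<sigma> * v\<^sup>2) * (sqrt \<sigma> * v\<^sup>2) / 2"
        using assms(1) by (simp add: S v(2) v_sq real_sqrt_pow2 power_mult_distrib flip: power2_eq_square)
      then show ?thesis
        using assms(1) v by simp
    qed
    ultimately show ?thesis
      by simp
  qed
  \<comment> \<open>The fourth root leaves \<open>v\<^sup>2\<close> on the left of the main
    inequality and \<open>v\<close> on the right, so one factor cancels and \<open>v\<close> is
    bounded.\<close>
  moreover have "ln u \<le> 4 * v"
  proof -
    have "ln u = 4 * ln v"
      using ln_realpow[of v 4] v by simp
    then show ?thesis
      using v ln_bound[of v] by simp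
  qed
  then have "L * ln u \<le> L * (4 * v)"
    using assms(2) by (intro mult_left_mono) auto
  ultimately have "sqrt \<sigma> * v\<^sup>2 / 2 \<le> L * (4 * v)"
    using bound by linarith
  then have "v \<le> 8 * L / sqrt \<sigma>"
    using v assms(1) by (simp add: power2_eq_square field_simps)
  then have "v ^ 4 \<le> (8 * L / sqrt \<sigma>) ^ 4"
    using v by (intro power_mono) auto
  also have "(sqrt \<sigma>) ^ 4 = \<sigma>\<^sup>2"
    using assms(1) power_mult[of "sqrt \<sigma>" 2 2] by simp
  then have "(8 * L / sqrt \<sigma>) ^ 4 = 4096 * L ^ 4 / \<sigma>\<^sup>2"
    by (simp add: power_divide power_mult_distrib)
  \<comment> \<open>The factor 4096 is \<open>8 ^ 4\<close>; it is halved because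
    \<open>S = \<sigma> * v ^ 4 / 2\<close>.\<close>
  finally show ?thesis
    using assms(1) v(2) by (simp add: S power2_eq_square field_simps)
qed

theorem theorem13:
  fixes f :: "real ^ 'n \<Rightarrow> real ^ 'm"
    and L :: "'m \<Rightarrow> real"
    and L_max \<Phi>_low \<sigma> \<Gamma>\<^sub>0 \<theta> :: real
    and x0 :: "real ^ 'n"
    and x g :: "nat \<Rightarrow> real ^ 'n"
    and k :: nat
  assumes "\<And>j. continuously_differentiable (\<lambda>y. f y $ j)"
    and "\<And>j. L j > 0"
    and "\<And>j y y'. norm (grad (\<lambda>z. f z $ j) y - grad (\<lambda>z. f z $ j) y') \<le> L j * norm (y - y')"
    and "L_max = Max (range L)"
    and "\<exists>z. weakly_efficient f z"
    and "\<And>y. max_component f y \<ge> \<Phi>_low"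
    and "0 < \<sigma>" "\<sigma> < 1"
    and "\<Gamma>\<^sub>0 = max_component f x0 - \<Phi>_low"
    and "mo_adagrad f x0 \<sigma> x g"
    and "\<theta> = Max {\<sigma>, \<sigma> / 2 * exp (2 * \<Gamma>\<^sub>0 / L_max), 2048 * L_max ^ 4 / \<sigma>}"
  shows "1 / real (k + 1) * (\<Sum>l=0..k. omega f (x l))
           = 1 / real (k + 1) * (\<Sum>l=0..k. (norm (g l))\<^sup>2)
       \<and> 1 / real (k + 1) * (\<Sum>l=0..k. (norm (g l))\<^sup>2) \<le> \<theta> / real (k + 1)"
proof -
  obtain lam w s where x_0: "x 0 = x0" and w_0: "w 0 = sqrt \<sigma>"
    and opt: "\<And>l. optimal_weights f (x l) (lam l)"
    and g: "\<And>l. g l = grad_comb f (x l) (lam l)"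
    and w_Suc: "\<And>l. w (Suc l) = sqrt ((w l)\<^sup>2 + (norm (g l))\<^sup>2)"
    and s: "\<And>l. s l = - ((1 / w (Suc l)) *\<^sub>R g l)"
    and x_Suc: "\<And>l. x (Suc l) = x l + s l"
    using assms(10) unfolding mo_adagrad_def by metis
  have L_le: "L j \<le> L_max" for j
    unfolding assms(4) by simp
  then have L_max: "0 < L_max"
    using assms(2) less_le_trans by blast
  have lip: "norm (grad (\<lambda>z. f z $ j) y - grad (\<lambda>z. f z $ j) y') \<le> L_max * norm (y - y')" for j y y'
    using assms(3)[of j y y'] L_le[of j] by (meson mult_right_mono norm_ge_zero order_trans)
  have diff: "(\<lambda>z. f z $ j) differentiable (at y)" for j y
    using assms(1) by (simp add: continuously_differentiable_def)
  have w_nonneg: "0 \<le> w (Suc l)" for l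
    by (simp add: w_Suc)
  have step: "max_component f (x (Suc l)) \<le> max_component f (x l) - (norm (g l))\<^sup>2 / w (Suc l)
      + L_max / 2 * ((norm (g l))\<^sup>2 / (w (Suc l))\<^sup>2)" for l
    using max_component_descent[OF diff lip opt, of "1 / w (Suc l)" l] w_nonneg[of l]
    by (simp add: x_Suc s flip: g) (simp add: power_divide)
  \<comment> \<open>The index runs over the steps 0 to \<open>k\<close>, so the matching scale is
    \<open>w (Suc k)\<close> and the last iterate is \<open>x (Suc k)\<close>.\<close>
  define S where "S = (\<Sum>l<Suc k. (norm (g l))\<^sup>2)"
  have "S / sqrt (\<sigma> + S) \<le> max_component f (x 0) - max_component f (x (Suc k))
      + L_max / 2 * ln ((\<sigma> + S) / \<sigma>)"
    unfolding S_def
    by (rule adagrad_weighted_sum_bound[where w = w and \<Phi> = "\<lambda>l. max_component f (x l)"])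
      (use assms(7) L_max w_0 w_Suc step in auto)
  also have "\<dots> \<le> \<Gamma>\<^sub>0 + L_max / 2 * ln ((\<sigma> + S) / \<sigma>)"
    using assms(6,9) x_0 by simp
  finally have log_bound: "S / sqrt (\<sigma> + S) \<le> \<Gamma>\<^sub>0 + L_max / 2 * ln ((\<sigma> + S) / \<sigma>)" .
  have "S \<le> \<theta>"
  \<comment> \<open>Exceeding \<theta> means exceeding all three entries; the first two trigger the
    logarithmic estimate, whose conclusion contradicts the third.\<close>
  proof (rule ccontr)
    assume "\<not> S \<le> \<theta>"
    then have "\<sigma> < S" "\<sigma> / 2 * exp (2 * \<Gamma>\<^sub>0 / L_max) < S" "2048 * L_max ^ 4 / \<sigma> < S"
      unfolding assms(11) by auto
    with adagrad_bound_from_log[OF assms(7) L_max log_bound] show False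
      by simp
  qed
  then have "(\<Sum>l=0..k. (norm (g l))\<^sup>2) \<le> \<theta>"
    by (simp add: S_def lessThan_Suc_atMost atLeast0AtMost)
  then have "1 / real (k + 1) * (\<Sum>l=0..k. (norm (g l))\<^sup>2) \<le> \<theta> / real (k + 1)"
    by (simp add: divide_right_mono)
  then show ?thesis
    using omega_eq_optimal_weights[OF opt] by (simp add: g)
qed

end
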